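(* Define, for any vertex $i\in\mathcal T$, $$W(i)=F(i)+\sum_{S\in\mathcal T:\ S+i\in\mathcal T,\ i\notin S}p(i,S)\,F(S+i),$$ and for any two distinct vertexes $i,j\in\mathcal T$ linked by an edge, $$V(i,j)=\sum_{T\in\mathcal T^m:\ i,j\in T}V_T(i,j).$$ Then for every vertex $i$, $$(m+1)\,W(i)=\sum_{j:\ i+j\in\mathcal T^1}V(i,j).$$
   Context: $\mathcal T$ is a finite simplicial complex whose simplexes have maximal dimension $m$; $\mathcal T^k$ is the set of its $k$-dimensional simplexes. $S\triangleleft T$ means that $S$ is a (nonempty) subsimplex of $T$. If $i$ is a vertex not in $S$, $S+i$ is the simplex obtained by adjoining $i$ to $S$; if $i$ is a vertex of $S$, $S-i$ is the face of $S$ opposite $i$. A vertex $i$ is identified with the $0$-dimensional simplex it spans, and $i+j$ is the edge joining $i$ and $j$. To each $S\in\mathcal T$ is attached a space $V(S)$ (the fiber above $S$; a smooth manifold, so that the derivatives below make sense). A field is $\Phi=(\Phi(S))_{S\in\mathcal T}\in\prod_{S\in\mathcal T}V(S)$; for $T\in\mathcal T^m$, $\Phi_T=(\Phi(S))_{S\triangleleft T}$. For each $T\in\mathcal T^m$ there is a (differentiable) Lagrangian $\mathcal L_T:\prod_{S\triangleleft T}V(S)\to\mathbb R$, and the global action is $\mathcal S(\Phi)=\sum_{T\in\mathcal T^m}\mathcal L_T(\Phi_T)$. A one-parameter group $\Lambda$ acts (differentiably) separately on each fiber, $\Lambda(S):\mathbb R\to\mathrm{Aut}(V(S))$, independently of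 any embedding of $S$ into a maximal simplex, and leaves each $\mathcal L_T$ invariant: $\mathcal L_T\big((\Lambda(S)[t]\Phi(S))_{S\triangleleft T}\big)=\mathcal L_T(\Phi_T)$ for all $t\in\mathbb R$ and all $\Phi$. For a given field $\Phi$ define: - infinitesimal generators $\xi(S)=\frac{d}{dt}\big|_{t=0}\Lambda(S)[t]\Phi(S)$; - local Euler–Lagrange functions $E_T(S)=\partial|_S\mathcal L_T(\Phi_T)$ for $S\triangleleft T\in\mathcal T^m$ (partial differential with respect to the variable in $V(S)$), and $F_T(S)=E_T(S)\,\xi(S)\in\mathbb R$; - global Euler–Lagrange functions $E(S)=\partial|_S\mathcal S(\Phi)=\sum_{T\in\mathcal T^m:\,S\triangleleft T}E_T(S)$, and $F(S)=E(S)\,\xi(S)\in\mathbb R$. Numbers $p(i,S)$ are chosen for each simplex $S\in\mathcal T$ and each vertex $i\notin S$ (independently of the maximal simplex containing $i$ and $S$), with $p(i,S)=0$ when $i$ and $S$ are not included in any common simplex of $\mathcal T$, and subject to the condition that for any simplex $S'\in\mathcal T$ of dimension at least $1$, $\sum_{i\in S'}p(i,S'-i)=1$. For $T\in\mathcal T^m$ and distinct vertexes $i,j\in T$, $$V_T(i,j)=F_T(i)-F_T(j)+\sum_{S\triangleleft T:\ i,j\notin S}\big(p(i,S)\,F_T(S+i)-p(j,S)\,F_T(S+j)\big).$$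
   Formalization: In V_T(i,j) the condition i,j∉S is applied termwise: i∉S for p(i,S)F_T(S+i) and j∉S for p(j,S)F_T(S+j); as printed the identity fails, e.g. for one edge with L=x_{edge}-x_0, translations, p(0,{1})=1, p(1,{0})=0. *)

theory Defs
  imports "HOL-Analysis.Analysis"
begin

section \<open>Simplicial complexes\<close>

text \<open>Complexes are abstract: a simplex is its nonempty finite set of vertices. Then
  \<open>S + i\<close> is \<open>insert i S\<close>, \<open>S - i\<close> is \<open>S - {i}\<close>, and the vertex \<open>i\<close>, seen as a simplex, is \<open>{i}\<close>.\<close>

definition abstract_complex :: "'v set set \<Rightarrow> bool" where
  "abstract_complex K \<longleftrightarrow> finite K \<and>
     (\<forall>S\<in>K. finite S \<and> S \<noteq> {} \<and> (\<forall>R. R \<subseteq> S \<and> R \<noteq> {} \<longrightarrow> R \<in> K))"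

definition simplex_dim :: "'v set \<Rightarrow> nat" where
  "simplex_dim S = card S - 1"

definition simplexes_of_dim :: "'v set set \<Rightarrow> nat \<Rightarrow> 'v set set" where
  "simplexes_of_dim K k = {S \<in> K. simplex_dim S = k}"

definition faces :: "'v set \<Rightarrow> 'v set set" where
  "faces T = {S. S \<subseteq> T \<and> S \<noteq> {}}"


section \<open>Smooth manifolds\<close>

text \<open>The charts of a manifold take values in a linear subspace \<open>model\<close> of one ambient Euclidean
  space. Manifolds of different dimensions thereby share a single HOL type, so the fibers above
  different simplexes may have different dimensions. A chart is a pair of its domain and its
  coordinate map; the values of the coordinate map outside the domain are irrelevant.\<close>

record ('a, 'e) manifold =
  space_of :: "'a topology"
  model :: "'e set"
  atlas :: "('a set \<times> ('a \<Rightarrow> 'e)) set"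

abbreviation points :: "('a, 'e) manifold \<Rightarrow> 'a set" where
  "points M \<equiv> topspace (space_of M)"

definition chart_inv :: "'a set \<times> ('a \<Rightarrow> 'e) \<Rightarrow> 'e \<Rightarrow> 'a" where
  "chart_inv c = inv_into (fst c) (snd c)"

text \<open>Here \<open>A\<close> is meant to be open in the subspace \<open>H\<close>, so that a derivative within \<open>A\<close> is
  determined on \<open>H\<close>.\<close>

primrec Ck_on :: "nat \<Rightarrow> 'e::euclidean_space set \<Rightarrow> 'e set \<Rightarrow> ('e \<Rightarrow> 'e) \<Rightarrow> bool" where
  "Ck_on 0 H A f \<longleftrightarrow> continuous_on A f"
| "Ck_on (Suc k) H A f \<longleftrightarrow>
     (\<exists>f'. (\<forall>x\<in>A. (f has_derivative f' x) (at x within A)) \<and> (\<forall>v\<in>H. Ck_on k H A (\<lambda>x. f' x v)))"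

definition smooth_manifold :: "('a, 'e::euclidean_space) manifold \<Rightarrow> bool" where
  "smooth_manifold M \<longleftrightarrow>
     Hausdorff_space (space_of M) \<and> second_countable (space_of M) \<and>
     subspace (model M) \<and>
     (\<forall>c\<in>atlas M. openin (space_of M) (fst c) \<and>
        openin (top_of_set (model M)) (snd c ` fst c) \<and>
        homeomorphic_map (subtopology (space_of M) (fst c)) (top_of_set (snd c ` fst c)) (snd c)) \<and>
     (\<Union>c\<in>atlas M. fst c) = points M \<and>
     (\<forall>c\<in>atlas M. \<forall>d\<in>atlas M. \<forall>k.
        Ck_on k (model M) (snd c ` (fst c \<inter> fst d)) (\<lambda>y. snd d (chart_inv c y)))"

definition charts_around :: "('a, 'e) manifold \<Rightarrow> 'a \<Rightarrow> ('a set \<times> ('a \<Rightarrow> 'e)) set" where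
  "charts_around M x = {c \<in> atlas M. x \<in> fst c}"

text \<open>Tangent vectors and differentials at \<open>x\<close> are written in the coordinates of one fixed chart
  around \<open>x\<close>, which identifies the tangent space at \<open>x\<close> with \<open>model M\<close>. By the chain rule, the
  value of a differential on a tangent vector does not depend on the chart.\<close>

definition chart_at :: "('a, 'e) manifold \<Rightarrow> 'a \<Rightarrow> 'a set \<times> ('a \<Rightarrow> 'e)" where
  "chart_at M x = (SOME c. c \<in> charts_around M x)"

definition velocity :: "('a, 'e::euclidean_space) manifold \<Rightarrow> (real \<Rightarrow> 'a) \<Rightarrow> 'e" where
  "velocity M \<gamma> = vector_derivative (\<lambda>t. snd (chart_at M (\<gamma> 0)) (\<gamma> t)) (at 0)"


section \<open>Fields, Lagrangians and one-parameter groups\<close>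

definition fields :: "'v set set \<Rightarrow> ('v set \<Rightarrow> ('a, 'e) manifold) \<Rightarrow> ('v set \<Rightarrow> 'a) set" where
  "fields K V = (\<Pi>\<^sub>E S\<in>K. points (V S))"

text \<open>Differentiability on the finite product of the fibers above the faces of \<open>T\<close>. In charts the
  product becomes an open subset of the product of the models, realised inside
  \<^typ>\<open>'e ^ ('v set)\<close>; this is where finiteness of the vertex type is used. The components of a
  vector at indices that are not faces of \<open>T\<close> have no influence on the function.\<close>

definition differentiable_on_fibers ::
    "('v::finite set \<Rightarrow> ('a, 'e::euclidean_space) manifold) \<Rightarrow> 'v set \<Rightarrow> (('v set \<Rightarrow> 'a) \<Rightarrow> real) \<Rightarrow> bool"
  where
  "differentiable_on_fibers V T f \<longleftrightarrow>
     (\<forall>\<Psi>\<in>fields (faces T) V. \<forall>c. (\<forall>S\<in>faces T. c S \<in> charts_around (V S) (\<Psi> S)) \<longrightarrow>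
        (\<lambda>y :: 'e ^ ('v set). f (\<lambda>S\<in>faces T. chart_inv (c S) (y $ S))) differentiable
          (at (\<chi> S. if S \<in> faces T then snd (c S) (\<Psi> S) else 0)
            within {y. \<forall>S\<in>faces T. y $ S \<in> model (V S)}))"

text \<open>The last conjunct is differentiability of the action in \<open>(t, x)\<close> jointly, in charts. Every
  \<open>\<theta> t\<close> is then an automorphism of \<open>M\<close>: a differentiable bijection with differentiable inverse
  \<open>\<theta> (- t)\<close>.\<close>

definition one_parameter_group ::
    "('a, 'e::euclidean_space) manifold \<Rightarrow> (real \<Rightarrow> 'a \<Rightarrow> 'a) \<Rightarrow> bool" where
  "one_parameter_group M \<theta> \<longleftrightarrow>
     (\<forall>t. \<theta> t \<in> points M \<rightarrow> points M) \<and>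
     (\<forall>x\<in>points M. \<theta> 0 x = x) \<and>
     (\<forall>s t. \<forall>x\<in>points M. \<theta> (s + t) x = \<theta> s (\<theta> t x)) \<and>
     continuous_map (prod_topology euclideanreal (space_of M)) (space_of M) (\<lambda>(t, x). \<theta> t x) \<and>
     (\<forall>t. \<forall>x\<in>points M. \<forall>c\<in>charts_around M x. \<forall>d\<in>charts_around M (\<theta> t x).
        (\<lambda>(s, y). snd d (\<theta> s (chart_inv c y))) differentiable
          (at (t, snd c x) within UNIV \<times> model M))"

definition invariant_lagrangian ::
    "('v set \<Rightarrow> ('a, 'e) manifold) \<Rightarrow> ('v set \<Rightarrow> real \<Rightarrow> 'a \<Rightarrow> 'a) \<Rightarrow> 'v set \<Rightarrow>
     (('v set \<Rightarrow> 'a) \<Rightarrow> real) \<Rightarrow> bool" where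
  "invariant_lagrangian V \<Lambda> T f \<longleftrightarrow>
     (\<forall>\<Psi>\<in>fields (faces T) V. \<forall>t. f (\<lambda>S\<in>faces T. \<Lambda> S t (\<Psi> S)) = f \<Psi>)"

text \<open>The domain of the Lagrangian \<open>L T\<close> is the set of fields over the faces of \<open>T\<close>.\<close>

definition local_action ::
    "('v set \<Rightarrow> ('v set \<Rightarrow> 'a) \<Rightarrow> real) \<Rightarrow> 'v set \<Rightarrow> ('v set \<Rightarrow> 'a) \<Rightarrow> real" where
  "local_action L T \<Phi> = L T (restrict \<Phi> (faces T))"

definition global_action ::
    "'v set set \<Rightarrow> nat \<Rightarrow> ('v set \<Rightarrow> ('v set \<Rightarrow> 'a) \<Rightarrow> real) \<Rightarrow> ('v set \<Rightarrow> 'a) \<Rightarrow> real" where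
  "global_action K m L \<Phi> = (\<Sum>T\<in>simplexes_of_dim K m. local_action L T \<Phi>)"


section \<open>Euler--Lagrange functions\<close>

definition generator ::
    "('v set \<Rightarrow> ('a, 'e::euclidean_space) manifold) \<Rightarrow> ('v set \<Rightarrow> real \<Rightarrow> 'a \<Rightarrow> 'a) \<Rightarrow>
     ('v set \<Rightarrow> 'a) \<Rightarrow> 'v set \<Rightarrow> 'e" where
  "generator V \<Lambda> \<Phi> S = velocity (V S) (\<lambda>t. \<Lambda> S t (\<Phi> S))"

text \<open>A derivative within the subspace \<open>model (V S)\<close> is determined on that subspace only, but this
  is where the generators lie.\<close>

definition partial_differential ::
    "('v set \<Rightarrow> ('a, 'e::euclidean_space) manifold) \<Rightarrow> (('v set \<Rightarrow> 'a) \<Rightarrow> real) \<Rightarrow>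
     ('v set \<Rightarrow> 'a) \<Rightarrow> 'v set \<Rightarrow> 'e \<Rightarrow> real" where
  "partial_differential V A \<Phi> S =
     (let c = chart_at (V S) (\<Phi> S) in
      frechet_derivative (\<lambda>y. A (\<Phi>(S := chart_inv c y))) (at (snd c (\<Phi> S)) within model (V S)))"

definition F_local ::
    "('v set \<Rightarrow> ('a, 'e::euclidean_space) manifold) \<Rightarrow> ('v set \<Rightarrow> ('v set \<Rightarrow> 'a) \<Rightarrow> real) \<Rightarrow>
     ('v set \<Rightarrow> real \<Rightarrow> 'a \<Rightarrow> 'a) \<Rightarrow> ('v set \<Rightarrow> 'a) \<Rightarrow> 'v set \<Rightarrow> 'v set \<Rightarrow> real" where
  "F_local V L \<Lambda> \<Phi> T S = partial_differential V (local_action L T) \<Phi> S (generator V \<Lambda> \<Phi> S)"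

definition F_global ::
    "'v set set \<Rightarrow> nat \<Rightarrow> ('v set \<Rightarrow> ('a, 'e::euclidean_space) manifold) \<Rightarrow>
     ('v set \<Rightarrow> ('v set \<Rightarrow> 'a) \<Rightarrow> real) \<Rightarrow> ('v set \<Rightarrow> real \<Rightarrow> 'a \<Rightarrow> 'a) \<Rightarrow> ('v set \<Rightarrow> 'a) \<Rightarrow>
     'v set \<Rightarrow> real" where
  "F_global K m V L \<Lambda> \<Phi> S = partial_differential V (global_action K m L) \<Phi> S (generator V \<Lambda> \<Phi> S)"


section \<open>Weights and currents\<close>

definition weights :: "'v set set \<Rightarrow> ('v \<Rightarrow> 'v set \<Rightarrow> real) \<Rightarrow> bool" where
  "weights K p \<longleftrightarrow>
     (\<forall>S\<in>K. \<forall>i. {i} \<in> K \<and> i \<notin> S \<and> \<not> (\<exists>T\<in>K. i \<in> T \<and> S \<subseteq> T) \<longrightarrow> p i S = 0) \<and>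
     (\<forall>S\<in>K. simplex_dim S \<ge> 1 \<longrightarrow> (\<Sum>i\<in>S. p i (S - {i})) = 1)"

text \<open>In the sum over the faces \<open>S\<close> in \<open>V\<^sub>T(i, j)\<close>, the printed side condition ``\<open>i, j \<notin> S\<close>'' is
  applied respectively: \<open>i \<notin> S\<close> in the term \<open>p(i, S) F\<^sub>T(S + i)\<close>, and \<open>j \<notin> S\<close> in the term
  \<open>p(j, S) F\<^sub>T(S + j)\<close>. This departs from the literal reading ``neither \<open>i\<close> nor \<open>j\<close> is in \<open>S\<close>'',
  which loses the faces containing the edge \<open>i + j\<close> and makes the identity for \<open>(m + 1) W(i)\<close>
  false, already for a single edge (\<open>m = 1\<close>) with weights other than \<open>1/2\<close>. The lemma
  \<open>V_local_alt\<close> exhibits the difference between the two readings. It vanishes when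
  \<open>p(i, R - i) = p(j, R - j)\<close> for all \<open>R\<close> containing \<open>i\<close> and \<open>j\<close>, in particular for uniform weights.\<close>

definition V_local ::
    "('v \<Rightarrow> 'v set \<Rightarrow> real) \<Rightarrow> ('v set \<Rightarrow> real) \<Rightarrow> 'v set \<Rightarrow> 'v \<Rightarrow> 'v \<Rightarrow> real" where
  "V_local p F T i j = F {i} - F {j}
     + ((\<Sum>S | S \<in> faces T \<and> i \<notin> S. p i S * F (insert i S))
        - (\<Sum>S | S \<in> faces T \<and> j \<notin> S. p j S * F (insert j S)))"

definition V_edge ::
    "'v set set \<Rightarrow> nat \<Rightarrow> ('v \<Rightarrow> 'v set \<Rightarrow> real) \<Rightarrow> ('v set \<Rightarrow> 'v set \<Rightarrow> real) \<Rightarrow> 'v \<Rightarrow> 'v \<Rightarrow> real"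
  where
  "V_edge K m p F i j =
     (\<Sum>T | T \<in> simplexes_of_dim K m \<and> i \<in> T \<and> j \<in> T. V_local p (F T) T i j)"

definition W_vertex ::
    "'v set set \<Rightarrow> ('v \<Rightarrow> 'v set \<Rightarrow> real) \<Rightarrow> ('v set \<Rightarrow> real) \<Rightarrow> 'v \<Rightarrow> real" where
  "W_vertex K p F i =
     F {i} + (\<Sum>S | S \<in> K \<and> insert i S \<in> K \<and> i \<notin> S. p i S * F (insert i S))"

lemma V_local_alt:
  assumes "finite T" "i \<in> T" "j \<in> T" "i \<noteq> j"
  shows "V_local p F T i j = F {i} - F {j}
     + (\<Sum>S | S \<in> faces T \<and> i \<notin> S \<and> j \<notin> S. p i S * F (insert i S) - p j S * F (insert j S))
     + (\<Sum>R | R \<in> faces T \<and> i \<in> R \<and> j \<in> R. (p i (R - {i}) - p j (R - {j})) * F R)"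
proof -
  have fin: "finite (faces T)"
    using assms(1) by (auto simp: faces_def intro: finite_subset[of _ "Pow T"])
  have split: "(\<Sum>S | S \<in> faces T \<and> a \<notin> S. p a S * F (insert a S)) =
      (\<Sum>S | S \<in> faces T \<and> a \<notin> S \<and> b \<notin> S. p a S * F (insert a S)) +
      (\<Sum>R | R \<in> faces T \<and> a \<in> R \<and> b \<in> R. p a (R - {a}) * F R)"
    if ab: "a \<in> T" "b \<in> T" "a \<noteq> b" for a b
  proof -
    have "{S. S \<in> faces T \<and> a \<notin> S} =
        {S. S \<in> faces T \<and> a \<notin> S \<and> b \<notin> S} \<union> {S. S \<in> faces T \<and> a \<notin> S \<and> b \<in> S}"
      by auto
    then have "(\<Sum>S | S \<in> faces T \<and> a \<notin> S. p a S * F (insert a S)) =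
        (\<Sum>S | S \<in> faces T \<and> a \<notin> S \<and> b \<notin> S. p a S * F (insert a S)) +
        (\<Sum>S | S \<in> faces T \<and> a \<notin> S \<and> b \<in> S. p a S * F (insert a S))"
      using fin by (subst sum.union_disjoint[symmetric]) auto
    also have "(\<Sum>S | S \<in> faces T \<and> a \<notin> S \<and> b \<in> S. p a S * F (insert a S)) =
        (\<Sum>R | R \<in> faces T \<and> a \<in> R \<and> b \<in> R. p a (R - {a}) * F R)"
      using ab
      by (intro sum.reindex_bij_witness[of _ "\<lambda>R. R - {a}" "insert a"])
        (auto simp: faces_def insert_absorb insert_Diff)
    finally show ?thesis .
  qed
  have "{S. S \<in> faces T \<and> j \<notin> S \<and> i \<notin> S} = {S. S \<in> faces T \<and> i \<notin> S \<and> j \<notin> S}"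
    "{S. S \<in> faces T \<and> j \<in> S \<and> i \<in> S} = {S. S \<in> faces T \<and> i \<in> S \<and> j \<in> S}"
    by auto
  then show ?thesis
    using split[of i j] split[of j i] assms
    by (simp add: V_local_def sum_subtractf left_diff_distrib)
qed

end

theory Submission
  imports Defs
begin

text \<open>On a single maximal simplex \<open>T\<close> the function \<open>V\<^sub>T(i, j)\<close> is a difference \<open>W\<^sub>T(i) - W\<^sub>T(j)\<close>,
  where \<open>W\<^sub>T\<close> is the vertex function of the complex of faces of \<open>T\<close>. As \<open>T\<close> has \<open>m + 1\<close> vertices,
  summing over the vertices \<open>j \<noteq> i\<close> of \<open>T\<close> gives \<open>(m + 1) W\<^sub>T(i) - (\<Sum>j\<in>T. W\<^sub>T(j))\<close>. Since the weights
  of the vertices of a simplex add up to 1, the last sum is \<open>\<Sum>S\<in>faces T. F\<^sub>T(S)\<close>, which is the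
  derivative of the Lagrangian along the group and hence 0. Finally \<open>W(i)\<close> is the sum of the
  \<open>W\<^sub>T(i)\<close> over the \<open>T\<close> containing \<open>i\<close>, because \<open>F(S) = (\<Sum>T. F\<^sub>T(S))\<close>.\<close>

section \<open>Derivatives within a subspace\<close>

text \<open>Serves to pull a function on a subspace back to lines, axis slices and orbits: it is
  enough that the inner map stays in the set within which the outer derivative is taken.\<close>

lemma has_derivative_compose_within:
  assumes "f ` S \<subseteq> T" "(f has_derivative f') (at x within S)"
    and "(g has_derivative g') (at (f x) within T)"
  shows "((\<lambda>x. g (f x)) has_derivative (\<lambda>v. g' (f' v))) (at x within S)"
  by (rule has_derivative_in_compose[OF assms(2) has_derivative_subset[OF assms(3,1)]])

lemma bounded_linear_axis: "bounded_linear (axis k :: 'b::euclidean_space \<Rightarrow> 'b ^ 'n::finite)"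
  by (simp add: linear_conv_bounded_linear[symmetric] linear_iff axis_def vec_eq_iff)

lemma sum_axis_eq_vec:
  fixes g :: "'n::finite \<Rightarrow> 'b::comm_monoid_add"
  shows "(\<Sum>k\<in>A. axis k (g k)) = (\<chi> k. if k \<in> A then g k else 0)"
proof -
  have "(\<Sum>k\<in>A. axis k (g k)) $ j = (if j \<in> A then g j else 0)" for j
    by (simp add: axis_def eq_commute[of j] if_distrib cong: if_cong)
  then show ?thesis
    by (simp add: vec_eq_iff)
qed

text \<open>The line through \<open>x\<close> in direction \<open>v\<close> stays in
  \<open>H\<close>. Along it both derivatives become ordinary derivatives in one real variable,
  which are unique; evaluating at 1 recovers \<open>v\<close>. Directions outside \<open>H\<close>
  are not controlled.\<close>

lemma has_derivative_within_subspace_unique: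
  fixes f :: "'a::real_normed_vector \<Rightarrow> 'b::real_normed_vector"
  assumes "subspace H" "x \<in> H" "v \<in> H"
    and A: "(f has_derivative A) (at x within H)"
    and B: "(f has_derivative B) (at x within H)"
  shows "A v = B v"
proof -
  have line: "(\<lambda>t. x + t *\<^sub>R v) ` UNIV \<subseteq> H"
    using assms(1-3) by (auto intro: subspace_add subspace_scale)
  have "((\<lambda>t. f (x + t *\<^sub>R v)) has_derivative (\<lambda>t. C (t *\<^sub>R v))) (at 0)"
    if "(f has_derivative C) (at x within H)" for C
  proof (rule has_derivative_compose_within[OF line])
    show "((\<lambda>t::real. x + t *\<^sub>R v) has_derivative (\<lambda>t. t *\<^sub>R v)) (at 0)"
      by (auto intro!: derivative_eq_intros)
  qed (use that in simp)
  from has_derivative_unique[OF this[OF A] this[OF B]] show ?thesis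
    by (metis scaleR_one)
qed

text \<open>Difference quotients lie in \<open>H\<close>, and a subspace of a Euclidean space is
  closed, so their limit lies there too.\<close>

lemma has_vector_derivative_in_subspace:
  fixes u :: "real \<Rightarrow> 'a::euclidean_space"
  assumes H: "subspace H"
    and u: "(u has_vector_derivative d) (at a)"
    and ev: "\<forall>\<^sub>F t in nhds a. u t \<in> H"
  shows "d \<in> H"
proof (rule Lim_in_closed_set)
  show "closed H"
    by (rule closed_subspace[OF H])
  have "u a \<in> H"
    using ev by (rule eventually_nhds_x_imp_x)
  moreover have "\<forall>\<^sub>F t in at a. u t \<in> H"
    using ev by (auto simp: eventually_at_filter elim: eventually_mono)
  ultimately show "\<forall>\<^sub>F t in at a. (1 / (t - a)) *\<^sub>R (u t - u a) \<in> H"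
    using H by (auto intro!: subspace_scale subspace_diff elim: eventually_mono)
  show "((\<lambda>t. (1 / (t - a)) *\<^sub>R (u t - u a)) \<longlongrightarrow> d) (at a)"
  proof (subst LIM_zero_iff[symmetric], subst tendsto_norm_zero_iff[symmetric])
    \<comment> \<open>The norm form of the derivative speaks of a normalised remainder; away from
      \<open>a\<close> this is exactly the distance from the difference quotient to
      \<open>d\<close>.\<close>
    have "norm (u t - u a - (t - a) *\<^sub>R d) / norm (t - a) =
        norm ((1 / (t - a)) *\<^sub>R (u t - u a) - d)" if "t \<noteq> a" for t
    proof -
      have "u t - u a - (t - a) *\<^sub>R d = (t - a) *\<^sub>R ((1 / (t - a)) *\<^sub>R (u t - u a) - d)"
        using that by (simp add: scaleR_diff_right)
      then show ?thesis
        using that by simp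
    qed
    moreover have "((\<lambda>t. norm (u t - u a - (t - a) *\<^sub>R d) / norm (t - a)) \<longlongrightarrow> 0) (at a)"
      using u by (simp add: has_vector_derivative_def has_derivative_iff_norm)
    ultimately show "((\<lambda>t. norm ((1 / (t - a)) *\<^sub>R (u t - u a) - d)) \<longlongrightarrow> 0) (at a)"
      by (auto elim!: Lim_transform_eventually simp: eventually_at_filter)
  qed
qed simp

section \<open>Charts and orbits\<close>

lemma chart_at_in_charts_around:
  assumes "smooth_manifold M" "x \<in> points M"
  shows "chart_at M x \<in> charts_around M x"
proof -
  have "\<exists>c. c \<in> charts_around M x"
    using assms unfolding smooth_manifold_def charts_around_def by blast
  then show ?thesis
    unfolding chart_at_def by (rule someI_ex)
qed

lemma chart_into_model:
  assumes "smooth_manifold M" "c \<in> atlas M" "x \<in> fst c"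
  shows "snd c x \<in> model M"
proof -
  have "openin (top_of_set (model M)) (snd c ` fst c)"
    using assms(1,2) unfolding smooth_manifold_def by blast
  then show ?thesis
    using assms(3) openin_imp_subset by blast
qed

lemma chart_inv_chart:
  assumes M: "smooth_manifold M" and c: "c \<in> atlas M" "x \<in> fst c"
  shows "chart_inv c (snd c x) = x"
proof -
  have "openin (space_of M) (fst c)"
    and "homeomorphic_map (subtopology (space_of M) (fst c)) (top_of_set (snd c ` fst c)) (snd c)"
    using M c(1) unfolding smooth_manifold_def by blast+
  then have "inj_on (snd c) (fst c)"
    using homeomorphic_imp_injective_map openin_subset
    by (metis topspace_subtopology_subset)
  then show ?thesis
    using c(2) by (simp add: chart_inv_def)
qed

text \<open>The orbit map is continuous and starts at \<open>x\<close>, inside the open chart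
  domain; so for small times the orbit can be read in a fixed chart.\<close>

lemma eventually_orbit_in_chart:
  assumes M: "smooth_manifold M" and \<theta>: "one_parameter_group M \<theta>"
    and x: "x \<in> points M" and c: "c \<in> charts_around M x"
  shows "\<forall>\<^sub>F t in nhds 0. \<theta> t x \<in> fst c"
proof -
  have "continuous_map (prod_topology euclideanreal (space_of M)) (space_of M) (\<lambda>(t, x). \<theta> t x)"
    using \<theta> unfolding one_parameter_group_def by blast
  moreover have "continuous_map euclideanreal (prod_topology euclideanreal (space_of M)) (\<lambda>t. (t, x))"
    using x by (simp add: continuous_map_pairwise o_def)
  ultimately have "continuous_map euclideanreal (space_of M) (\<lambda>t. \<theta> t x)"
    by (auto dest: continuous_map_compose simp: o_def)
  moreover have "openin (space_of M) (fst c)"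
    using M c unfolding smooth_manifold_def charts_around_def by blast
  ultimately have "open {t. \<theta> t x \<in> fst c}"
    using openin_continuous_map_preimage by fastforce
  moreover have "\<theta> 0 x \<in> fst c"
    using \<theta> x c by (simp add: one_parameter_group_def charts_around_def)
  ultimately show ?thesis
    unfolding eventually_nhds by blast
qed

text \<open>\<open>vector_derivative\<close> is meaningful only once differentiability is known.
  That comes from joint differentiability of the action, with the space coordinate frozen at that of
  \<open>x\<close>.\<close>

lemma orbit_has_velocity:
  assumes M: "smooth_manifold M" and \<theta>: "one_parameter_group M \<theta>" and x: "x \<in> points M"
  shows "((\<lambda>t. snd (chart_at M x) (\<theta> t x)) has_vector_derivative velocity M (\<lambda>t. \<theta> t x)) (at 0)"
proof -
  define c where "c = chart_at M x"
  have c: "c \<in> charts_around M x"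
    unfolding c_def by (rule chart_at_in_charts_around[OF M x])
  then have c': "c \<in> atlas M" "x \<in> fst c"
    by (auto simp: charts_around_def)
  have \<theta>0: "\<theta> 0 x = x"
    using \<theta> x by (simp add: one_parameter_group_def)
  \<comment> \<open>Since \<open>\<theta> 0 x = x\<close>, the same chart can be used for source and
    target at time 0.\<close>
  have "(\<lambda>(s, y). snd c (\<theta> s (chart_inv c y))) differentiable (at (0, snd c x) within UNIV \<times> model M)"
    using \<theta> x c \<theta>0 unfolding one_parameter_group_def by metis
  then obtain D where D: "((\<lambda>(s, y). snd c (\<theta> s (chart_inv c y))) has_derivative D)
      (at (0, snd c x) within UNIV \<times> model M)"
    by (auto simp: differentiable_def)
  have "((\<lambda>s. (\<lambda>(s, y). snd c (\<theta> s (chart_inv c y))) (s, snd c x)) has_derivative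
      (\<lambda>s. D (s, 0))) (at 0)"
  proof (rule has_derivative_compose_within[where f = "\<lambda>s. (s, snd c x)"])
    show "(\<lambda>s::real. (s, snd c x)) ` UNIV \<subseteq> UNIV \<times> model M"
      using chart_into_model[OF M c'] by auto
    show "((\<lambda>s::real. (s, snd c x)) has_derivative (\<lambda>s. (s, 0))) (at 0)"
      by (auto intro!: derivative_eq_intros)
  qed (rule D)
  then have "(\<lambda>s. snd c (\<theta> s x)) differentiable (at 0)"
    unfolding differentiable_def by (auto simp: chart_inv_chart[OF M c'])
  then show ?thesis
    by (simp add: velocity_def \<theta>0 c_def vector_derivative_works)
qed

text \<open>For small times the coordinates of the orbit lie in the model, hence so does their
  derivative. This puts the generators where partial differentials are determined.\<close>

lemma velocity_in_model:
  assumes M: "smooth_manifold M" and \<theta>: "one_parameter_group M \<theta>" and x: "x \<in> points M"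
  shows "velocity M (\<lambda>t. \<theta> t x) \<in> model M"
proof (rule has_vector_derivative_in_subspace[OF _ orbit_has_velocity[OF assms]])
  show "subspace (model M)"
    using M by (simp add: smooth_manifold_def)
  have c: "chart_at M x \<in> charts_around M x"
    by (rule chart_at_in_charts_around[OF M x])
  show "\<forall>\<^sub>F t in nhds 0. snd (chart_at M x) (\<theta> t x) \<in> model M"
    using eventually_orbit_in_chart[OF M \<theta> x c] by (rule eventually_mono)
      (use c in \<open>simp add: charts_around_def chart_into_model[OF M]\<close>)
qed

section \<open>Euler--Lagrange functions\<close>

text \<open>\<open>frechet_derivative\<close> within the model is one chosen derivative, which may
  differ from \<open>D\<close> off the model. The generator lies in the model, where the two must
  agree.\<close>

lemma partial_differential_eqI:
  assumes M: "smooth_manifold (V S)" and \<theta>: "one_parameter_group (V S) (\<Lambda> S)"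
    and x: "\<Phi> S \<in> points (V S)"
    and D: "((\<lambda>y. A (\<Phi>(S := chart_inv (chart_at (V S) (\<Phi> S)) y))) has_derivative D)
      (at (snd (chart_at (V S) (\<Phi> S)) (\<Phi> S)) within model (V S))"
  shows "partial_differential V A \<Phi> S (generator V \<Lambda> \<Phi> S) = D (generator V \<Lambda> \<Phi> S)"
proof -
  have "chart_at (V S) (\<Phi> S) \<in> charts_around (V S) (\<Phi> S)"
    by (rule chart_at_in_charts_around[OF M x])
  then have "snd (chart_at (V S) (\<Phi> S)) (\<Phi> S) \<in> model (V S)"
    by (auto simp: charts_around_def intro: chart_into_model[OF M])
  moreover have "subspace (model (V S))"
    using M by (simp add: smooth_manifold_def)
  moreover have "generator V \<Lambda> \<Phi> S \<in> model (V S)"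
    unfolding generator_def by (rule velocity_in_model[OF M \<theta> x])
  moreover have "((\<lambda>y. A (\<Phi>(S := chart_inv (chart_at (V S) (\<Phi> S)) y))) has_derivative
      partial_differential V A \<Phi> S)
      (at (snd (chart_at (V S) (\<Phi> S)) (\<Phi> S)) within model (V S))"
    using D unfolding partial_differential_def Let_def
    by (auto simp: frechet_derivative_works[symmetric] differentiable_def)
  ultimately show ?thesis
    using D has_derivative_within_subspace_unique by blast
qed

lemma local_action_fun_upd:
  assumes "S \<notin> faces T"
  shows "local_action L T (\<Phi>(S := x)) = local_action L T \<Phi>"
  unfolding local_action_def using assms by (auto intro!: arg_cong[of _ _ "L T"])

section \<open>The Lagrangian of a single simplex in charts\<close>

locale fibers_over_simplex =
  fixes V :: "'v::finite set \<Rightarrow> ('a, 'e::euclidean_space) manifold"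
    and L :: "'v set \<Rightarrow> ('v set \<Rightarrow> 'a) \<Rightarrow> real"
    and \<Lambda> :: "'v set \<Rightarrow> real \<Rightarrow> 'a \<Rightarrow> 'a"
    and \<Phi> :: "'v set \<Rightarrow> 'a"
    and T :: "'v set"
  assumes fiber: "\<And>S. S \<in> faces T \<Longrightarrow> smooth_manifold (V S)"
    and group: "\<And>S. S \<in> faces T \<Longrightarrow> one_parameter_group (V S) (\<Lambda> S)"
    and field: "\<And>S. S \<in> faces T \<Longrightarrow> \<Phi> S \<in> points (V S)"
    and lagrangian: "differentiable_on_fibers V T (L T)"
begin

abbreviation chart :: "'v set \<Rightarrow> 'a set \<times> ('a \<Rightarrow> 'e)" where
  "chart S \<equiv> chart_at (V S) (\<Phi> S)"

lemma chart: "S \<in> faces T \<Longrightarrow> chart S \<in> charts_around (V S) (\<Phi> S)"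
  by (simp add: chart_at_in_charts_around fiber field)

lemma chart_point_in_model: "S \<in> faces T \<Longrightarrow> snd (chart S) (\<Phi> S) \<in> model (V S)"
  using chart[of S] by (auto simp: charts_around_def intro: chart_into_model fiber)

lemma chart_inv_point: "S \<in> faces T \<Longrightarrow> chart_inv (chart S) (snd (chart S) (\<Phi> S)) = \<Phi> S"
  using chart[of S] by (auto simp: charts_around_def intro: chart_inv_chart fiber)

text \<open>The zeros off the faces match the point at which \<open>differentiable_on_fibers\<close>
  asserts differentiability.\<close>

definition base :: "'e ^ ('v set)" where
  "base = (\<chi> S. if S \<in> faces T then snd (chart S) (\<Phi> S) else 0)"

lemma base_nth: "S \<in> faces T \<Longrightarrow> base $ S = snd (chart S) (\<Phi> S)"
  by (simp add: base_def)

definition models :: "('e ^ ('v set)) set" where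
  "models = {y. \<forall>S\<in>faces T. y $ S \<in> model (V S)}"

definition lagrangian_in_charts :: "'e ^ ('v set) \<Rightarrow> real" where
  "lagrangian_in_charts y = L T (\<lambda>S\<in>faces T. chart_inv (chart S) (y $ S))"

lemma restrict_field: "restrict \<Phi> (faces T) \<in> fields (faces T) V"
  using field by (auto simp: fields_def)

lemma lagrangian_has_derivative:
  obtains D where "(lagrangian_in_charts has_derivative D) (at base within models)"
proof -
  have "(\<lambda>y. L T (\<lambda>S\<in>faces T. chart_inv (chart S) (y $ S))) differentiable
      (at (\<chi> S. if S \<in> faces T then snd (chart S) (restrict \<Phi> (faces T) S) else 0) within models)"
    using lagrangian restrict_field chart
    unfolding differentiable_on_fibers_def models_def by fastforce
  also have "(\<chi> S. if S \<in> faces T then snd (chart S) (restrict \<Phi> (faces T) S) else 0) = base"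
    by (auto simp: base_def vec_eq_iff)
  finally show ?thesis
    using that unfolding differentiable_def lagrangian_in_charts_def by blast
qed

text \<open>A partial differential is the total one restricted to an axis: the path
  \<open>?\<gamma>\<close> moves only the component at \<open>S\<close> and passes through
  \<open>base\<close>.\<close>

lemma local_action_has_derivative:
  assumes D: "(lagrangian_in_charts has_derivative D) (at base within models)"
    and S: "S \<in> faces T"
  shows "((\<lambda>y. local_action L T (\<Phi>(S := chart_inv (chart S) y))) has_derivative (\<lambda>v. D (axis S v)))
    (at (snd (chart S) (\<Phi> S)) within model (V S))"
proof -
  let ?x = "snd (chart S) (\<Phi> S)"
  let ?\<gamma> = "\<lambda>y. base + axis S (y - ?x)"
  have \<gamma>_nth: "?\<gamma> y $ R = (if R = S then y else base $ R)" for y R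
    using S by (auto simp: axis_def base_def)
  have "((\<lambda>y. lagrangian_in_charts (?\<gamma> y)) has_derivative (\<lambda>v. D (axis S v))) (at ?x within model (V S))"
  proof (rule has_derivative_compose_within[where f = ?\<gamma>])
    show "?\<gamma> ` model (V S) \<subseteq> models"
      using chart_point_in_model unfolding models_def by (auto simp only: \<gamma>_nth) (simp add: base_nth)
    show "(?\<gamma> has_derivative axis S) (at ?x within model (V S))"
      by (auto intro!: derivative_eq_intros bounded_linear.has_derivative[OF bounded_linear_axis])
    have "?\<gamma> ?x = base"
      by (simp add: vec_eq_iff axis_def)
    then show "(lagrangian_in_charts has_derivative D) (at (?\<gamma> ?x) within models)"
      using D by (simp only:)
  qed
  \<comment> \<open>At the faces other than \<open>S\<close> the inverse chart undoes the chart and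
    gives back the field.\<close>
  moreover have "lagrangian_in_charts (?\<gamma> y) = local_action L T (\<Phi>(S := chart_inv (chart S) y))" for y
    unfolding lagrangian_in_charts_def local_action_def
    by (rule arg_cong[of _ _ "L T"])
      (simp add: fun_eq_iff \<gamma>_nth base_nth chart_inv_point del: vector_add_component)
  ultimately show ?thesis
    by simp
qed

text \<open>Exposes an actual derivative along with its value on the generator, so that the
  derivatives for several simplexes can be added.\<close>

lemma F_local_has_derivative:
  assumes S: "S \<in> faces T"
  obtains D where
    "((\<lambda>y. local_action L T (\<Phi>(S := chart_inv (chart S) y))) has_derivative D)
      (at (snd (chart S) (\<Phi> S)) within model (V S))"
    "F_local V L \<Lambda> \<Phi> T S = D (generator V \<Lambda> \<Phi> S)"
proof -
  obtain D where D: "(lagrangian_in_charts has_derivative D) (at base within models)"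
    by (rule lagrangian_has_derivative)
  note * = local_action_has_derivative[OF D S]
  have "F_local V L \<Lambda> \<Phi> T S = D (axis S (generator V \<Lambda> \<Phi> S))"
    unfolding F_local_def by (rule partial_differential_eqI) (intro fiber group field S *)+
  with * show ?thesis
    by (rule that)
qed

text \<open>By invariance the Lagrangian is constant along the simultaneous orbit in all fibers; the
  chain rule identifies the derivative of this constant with \<open>D\<close> on the vector of
  generators.\<close>

lemma lagrangian_derivative_along_orbit:
  assumes D: "(lagrangian_in_charts has_derivative D) (at base within models)"
    and inv: "invariant_lagrangian V \<Lambda> T (L T)"
  shows "D (\<Sum>S\<in>faces T. axis S (generator V \<Lambda> \<Phi> S)) = 0"
proof -
  define \<xi> :: "'e ^ ('v set)" where "\<xi> = (\<Sum>S\<in>faces T. axis S (generator V \<Lambda> \<Phi> S))"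
  \<comment> \<open>The orbit of the whole field in the fixed charts, padded by 0 off the faces so
    that it starts exactly at \<open>base\<close>.\<close>
  define u :: "real \<Rightarrow> 'e ^ ('v set)" where
    "u t = (\<Sum>S\<in>faces T. axis S (snd (chart S) (\<Lambda> S t (\<Phi> S))))" for t
  have u_nth: "u t $ S = snd (chart S) (\<Lambda> S t (\<Phi> S))" if "S \<in> faces T" for S t
    using that by (simp add: u_def sum_axis_eq_vec)
  have u0: "u 0 = base"
    using group field by (auto simp: u_def sum_axis_eq_vec base_def vec_eq_iff one_parameter_group_def)
  have "(u has_derivative (\<lambda>t. \<Sum>S\<in>faces T. axis S (t *\<^sub>R generator V \<Lambda> \<Phi> S))) (at 0)"
    unfolding u_def
    using orbit_has_velocity[OF fiber group field]
    by (intro has_derivative_sum bounded_linear.has_derivative[OF bounded_linear_axis])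
      (simp add: generator_def has_vector_derivative_def)
  then have u: "(u has_derivative (\<lambda>t. t *\<^sub>R \<xi>)) (at 0)"
    by (simp add: \<xi>_def scaleR_sum_right linear_cmul[OF bounded_linear.linear[OF bounded_linear_axis]])
  have "\<forall>\<^sub>F t in nhds 0. \<forall>S\<in>faces T. \<Lambda> S t (\<Phi> S) \<in> fst (chart S)"
    by (intro eventually_ball_finite ballI finite eventually_orbit_in_chart[OF fiber group field chart])
  \<comment> \<open>There are finitely many faces, so one neighbourhood of 0 keeps the orbits in all
    charts at once.\<close>
  then obtain N where N: "open N" "0 \<in> N"
    and inN: "\<And>t S. t \<in> N \<Longrightarrow> S \<in> faces T \<Longrightarrow> \<Lambda> S t (\<Phi> S) \<in> fst (chart S)"
    unfolding eventually_nhds by blast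
  have atlas: "chart S \<in> atlas (V S)" if "S \<in> faces T" for S
    using chart[OF that] by (simp add: charts_around_def)
  have "((\<lambda>t. lagrangian_in_charts (u t)) has_derivative (\<lambda>t. D (t *\<^sub>R \<xi>))) (at 0 within N)"
  proof (rule has_derivative_compose_within[where f = u])
    show "u ` N \<subseteq> models"
      unfolding models_def by (auto simp: u_nth intro!: chart_into_model[OF fiber atlas inN])
    show "(u has_derivative (\<lambda>t. t *\<^sub>R \<xi>)) (at 0 within N)"
      by (rule has_derivative_at_withinI[OF u])
  qed (use D u0 in simp)
  moreover have "lagrangian_in_charts (u t) = local_action L T \<Phi>" if "t \<in> N" for t
  proof -
    have "lagrangian_in_charts (u t) = L T (\<lambda>S\<in>faces T. \<Lambda> S t (restrict \<Phi> (faces T) S))"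
      unfolding lagrangian_in_charts_def
      by (rule arg_cong[of _ _ "L T"])
        (auto simp: fun_eq_iff u_nth intro!: chart_inv_chart fiber atlas inN that)
    also have "\<dots> = local_action L T \<Phi>"
      using inv restrict_field unfolding invariant_lagrangian_def local_action_def by blast
    finally show ?thesis .
  qed
  ultimately have "((\<lambda>t. local_action L T \<Phi>) has_derivative (\<lambda>t. D (t *\<^sub>R \<xi>))) (at 0 within N)"
    using has_derivative_transform[OF N(2), of "\<lambda>t. local_action L T \<Phi>"] by metis
  \<comment> \<open>\<open>N\<close> is open, so the derivative within it is an ordinary one and
    must be that of a constant.\<close>
  then have "((\<lambda>t. local_action L T \<Phi>) has_derivative (\<lambda>t. D (t *\<^sub>R \<xi>))) (at 0)"
    unfolding at_within_open[OF N(2,1)] .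
  then have "(\<lambda>t. D (t *\<^sub>R \<xi>)) = (\<lambda>_. 0)"
    using has_derivative_const by (rule has_derivative_unique)
  from fun_cong[OF this, of 1] show ?thesis
    by (simp add: \<xi>_def)
qed

text \<open>All partial differentials are values of one linear map \<open>D\<close> on axis vectors,
  so their sum is \<open>D\<close> in the direction of the orbit.\<close>

lemma sum_F_local_eq_0:
  assumes "invariant_lagrangian V \<Lambda> T (L T)"
  shows "(\<Sum>S\<in>faces T. F_local V L \<Lambda> \<Phi> T S) = 0"
proof -
  obtain D where D: "(lagrangian_in_charts has_derivative D) (at base within models)"
    by (rule lagrangian_has_derivative)
  have "linear D"
    using D by (rule has_derivative_linear)
  have "(\<Sum>S\<in>faces T. F_local V L \<Lambda> \<Phi> T S) = (\<Sum>S\<in>faces T. D (axis S (generator V \<Lambda> \<Phi> S)))"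
    unfolding F_local_def
    by (intro sum.cong refl partial_differential_eqI[OF fiber group field] local_action_has_derivative D)
  also have "\<dots> = D (\<Sum>S\<in>faces T. axis S (generator V \<Lambda> \<Phi> S))"
    by (rule linear_sum[OF \<open>linear D\<close>, symmetric])
  also have "\<dots> = 0"
    by (rule lagrangian_derivative_along_orbit[OF D assms])
  finally show ?thesis .
qed

end

text \<open>The global action is a finite sum of local ones, and differentiation is
  additive.\<close>

lemma F_global_eq_sum:
  assumes over: "\<And>T. T \<in> simplexes_of_dim K m \<Longrightarrow> fibers_over_simplex V L \<Lambda> \<Phi> T"
    and M: "smooth_manifold (V S)" and \<theta>: "one_parameter_group (V S) (\<Lambda> S)"
    and x: "\<Phi> S \<in> points (V S)"
  shows "F_global K m V L \<Lambda> \<Phi> S =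
    (\<Sum>T | T \<in> simplexes_of_dim K m \<and> S \<in> faces T. F_local V L \<Lambda> \<Phi> T S)"
proof -
  let ?\<xi> = "generator V \<Lambda> \<Phi> S"
  \<comment> \<open>Simplexes without the face \<open>S\<close> are included with derivative 0:
    their local action does not depend on the variable at \<open>S\<close>.\<close>
  have "\<exists>D. ((\<lambda>y. local_action L T (\<Phi>(S := chart_inv (chart_at (V S) (\<Phi> S)) y))) has_derivative D)
      (at (snd (chart_at (V S) (\<Phi> S)) (\<Phi> S)) within model (V S)) \<and>
      D ?\<xi> = (if S \<in> faces T then F_local V L \<Lambda> \<Phi> T S else 0)"
    if "T \<in> simplexes_of_dim K m" for T
  proof (cases "S \<in> faces T")
    case True
    then show ?thesis
      using fibers_over_simplex.F_local_has_derivative[OF over[OF that]] by metis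
  next
    case False
    then show ?thesis
      by (intro exI[of _ "\<lambda>_. 0"]) (simp add: local_action_fun_upd)
  qed
  then obtain D where D: "\<And>T. T \<in> simplexes_of_dim K m \<Longrightarrow>
      ((\<lambda>y. local_action L T (\<Phi>(S := chart_inv (chart_at (V S) (\<Phi> S)) y))) has_derivative D T)
        (at (snd (chart_at (V S) (\<Phi> S)) (\<Phi> S)) within model (V S))"
    and D\<xi>: "\<And>T. T \<in> simplexes_of_dim K m \<Longrightarrow>
      D T ?\<xi> = (if S \<in> faces T then F_local V L \<Lambda> \<Phi> T S else 0)"
    by metis
  have "F_global K m V L \<Lambda> \<Phi> S = (\<Sum>T\<in>simplexes_of_dim K m. D T ?\<xi>)"
    unfolding F_global_def
    by (rule partial_differential_eqI[where D = "\<lambda>v. \<Sum>T\<in>simplexes_of_dim K m. D T v"])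
      (auto simp: global_action_def intro!: M \<theta> x has_derivative_sum D)
  also have "\<dots> = (\<Sum>T\<in>simplexes_of_dim K m. if S \<in> faces T then F_local V L \<Lambda> \<Phi> T S else 0)"
    by (rule sum.cong[OF refl D\<xi>])
  also have "\<dots> = (\<Sum>T | T \<in> simplexes_of_dim K m \<and> S \<in> faces T. F_local V L \<Lambda> \<Phi> T S)"
    by (rule sum.inter_filter[symmetric]) simp
  finally show ?thesis .
qed

section \<open>Summation over a simplex\<close>

lemma finite_faces: "finite T \<Longrightarrow> finite (faces T)"
  by (auto simp: faces_def intro: finite_subset[of _ "Pow T"])

text \<open>Adjoining a vertex of \<open>T\<close> to a face of \<open>T\<close> always gives a
  face, so the sums on both sides have the same range. The case \<open>i = j\<close> is allowed,
  with value 0.\<close>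

lemma V_local_eq_W_vertex_diff:
  assumes "i \<in> T" "j \<in> T"
  shows "V_local p F T i j = W_vertex (faces T) p F i - W_vertex (faces T) p F j"
proof -
  have "{S. S \<in> faces T \<and> insert k S \<in> faces T \<and> k \<notin> S} = {S. S \<in> faces T \<and> k \<notin> S}"
    if "k \<in> T" for k
    using that by (auto simp: faces_def)
  with assms show ?thesis
    by (simp add: V_local_def W_vertex_def)
qed

text \<open>Double counting: \<open>F R\<close> is collected once from each vertex \<open>i\<close>
  of \<open>R\<close>, with weight \<open>p i (R - {i})\<close>, and these weights add up to 1. A
  single vertex is collected from the leading term \<open>F {i}\<close>.\<close>

lemma sum_W_vertex_faces:
  assumes T: "finite T"
    and p: "\<And>R. R \<in> faces T \<Longrightarrow> card R \<noteq> 1 \<Longrightarrow> (\<Sum>i\<in>R. p i (R - {i})) = 1"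
  shows "(\<Sum>i\<in>T. W_vertex (faces T) p F i) = (\<Sum>R\<in>faces T. F R)"
proof -
  note fin = finite_faces[OF T]
  let ?B = "{R \<in> faces T. card R \<noteq> 1}"
  let ?A = "\<lambda>i. {S. S \<in> faces T \<and> insert i S \<in> faces T \<and> i \<notin> S}"
  have finR: "finite R" if "R \<in> faces T" for R
    using that T by (auto simp: faces_def intro: finite_subset)
  have "(\<Sum>i\<in>T. \<Sum>S\<in>?A i. p i S * F (insert i S)) =
      (\<Sum>(i, S)\<in>Sigma T ?A. p i S * F (insert i S))"
    using T fin by (subst sum.Sigma) auto
  \<comment> \<open>Pairs correspond by \<open>R = insert i S\<close>. Faces in \<open>?B\<close>
    have at least two vertices, so \<open>R - {i}\<close> is nonempty and again a face.\<close>
  also have "\<dots> = (\<Sum>(R, i)\<in>Sigma ?B (\<lambda>R. R). p i (R - {i}) * F R)"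
    by (rule sum.reindex_bij_witness[of _ "\<lambda>(R, i). (i, R - {i})" "\<lambda>(i, S). (insert i S, i)"])
      (use finR in \<open>auto simp: faces_def insert_absorb card_1_singleton_iff\<close>)
  also have "\<dots> = (\<Sum>R\<in>?B. (\<Sum>i\<in>R. p i (R - {i})) * F R)"
    using fin finR by (subst sum.Sigma[symmetric]) (auto simp: sum_distrib_right)
  also have "\<dots> = (\<Sum>R\<in>?B. F R)"
    using p by simp
  finally have "(\<Sum>i\<in>T. W_vertex (faces T) p F i) = (\<Sum>i\<in>T. F {i}) + (\<Sum>R\<in>?B. F R)"
    by (simp add: W_vertex_def sum.distrib)
  also have "(\<Sum>i\<in>T. F {i}) = (\<Sum>R | R \<in> faces T \<and> card R = 1. F R)"
    by (rule sum.reindex_bij_witness[of _ the_elem "\<lambda>i. {i}"])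
      (auto simp: faces_def card_1_singleton_iff)
  also have "\<dots> + (\<Sum>R\<in>?B. F R) = (\<Sum>R\<in>faces T. F R)"
    using fin by (subst sum.union_disjoint[symmetric]) (auto intro!: sum.cong)
  finally show ?thesis .
qed

lemma sum_V_local:
  assumes T: "finite T" "i \<in> T"
    and p: "\<And>R. R \<in> faces T \<Longrightarrow> card R \<noteq> 1 \<Longrightarrow> (\<Sum>i\<in>R. p i (R - {i})) = 1"
    and F: "(\<Sum>R\<in>faces T. F R) = 0"
  shows "(\<Sum>j\<in>T - {i}. V_local p F T i j) = real (card T) * W_vertex (faces T) p F i"
proof -
  have "(\<Sum>j\<in>T - {i}. V_local p F T i j) = (\<Sum>j\<in>T. V_local p F T i j)"
    \<comment> \<open>The added term at \<open>j = i\<close> is zero.\<close>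
    using T by (intro sum.mono_neutral_left) (auto simp: V_local_eq_W_vertex_diff)
  also have "\<dots> = (\<Sum>j\<in>T. W_vertex (faces T) p F i - W_vertex (faces T) p F j)"
    using T by (intro sum.cong) (auto simp: V_local_eq_W_vertex_diff)
  also have "\<dots> = real (card T) * W_vertex (faces T) p F i"
    using sum_W_vertex_faces[OF T(1) p, of F] F by (simp add: sum_subtractf)
  finally show ?thesis .
qed

text \<open>Substitute the local sums for \<open>G\<close> and exchange summations: a simplex with
  face \<open>insert i S\<close> contains \<open>i\<close>, and then has \<open>S\<close> as a face
  as well.\<close>

lemma W_vertex_eq_sum:
  assumes K: "abstract_complex K" "\<T> \<subseteq> K"
    and G: "\<And>S. S \<in> K \<Longrightarrow> G S = (\<Sum>T | T \<in> \<T> \<and> S \<in> faces T. F T S)"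
    and i: "{i} \<in> K"
  shows "W_vertex K p G i = (\<Sum>T | T \<in> \<T> \<and> i \<in> T. W_vertex (faces T) p (F T) i)"
proof -
  have finK: "finite K" and finT: "finite \<T>"
    using K by (auto simp: abstract_complex_def intro: finite_subset)
  have faces_K: "faces T \<subseteq> K" if "T \<in> \<T>" for T
    using K that by (auto simp: abstract_complex_def faces_def)
  have finf: "finite (faces T)" if "T \<in> \<T>" for T
    using faces_K[OF that] finK by (rule finite_subset)
  let ?A = "{S. S \<in> K \<and> insert i S \<in> K \<and> i \<notin> S}"
  let ?I = "{T. T \<in> \<T> \<and> i \<in> T}"
  have "(\<Sum>S\<in>?A. p i S * G (insert i S)) =
      (\<Sum>S\<in>?A. \<Sum>T | T \<in> \<T> \<and> insert i S \<in> faces T. p i S * F T (insert i S))"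
    by (simp add: G sum_distrib_left)
  also have "\<dots> = (\<Sum>S\<in>?A. \<Sum>T | T \<in> ?I \<and> insert i S \<in> faces T. p i S * F T (insert i S))"
    by (intro sum.cong refl) (auto simp: faces_def)
  also have "\<dots> = (\<Sum>T\<in>?I. \<Sum>S | S \<in> ?A \<and> insert i S \<in> faces T. p i S * F T (insert i S))"
    using finK finT by (intro sum.swap_restrict) auto
  also have "\<dots> = (\<Sum>T\<in>?I. \<Sum>S | S \<in> faces T \<and> insert i S \<in> faces T \<and> i \<notin> S.
      p i S * F T (insert i S))"
  proof (intro sum.cong refl)
    fix T assume "T \<in> ?I"
    then have "faces T \<subseteq> K"
      using faces_K by simp
    \<comment> \<open>Membership in \<open>K\<close> supplies the nonemptiness that
      \<open>faces\<close> demands.\<close>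
    moreover have "S \<in> faces T" if "S \<in> K" "insert i S \<in> faces T" for S
    proof -
      have "S \<noteq> {}"
        using K(1) that(1) unfolding abstract_complex_def by blast
      then show ?thesis
        using that(2) by (simp add: faces_def)
    qed
    ultimately show "{S. S \<in> ?A \<and> insert i S \<in> faces T} =
        {S. S \<in> faces T \<and> insert i S \<in> faces T \<and> i \<notin> S}"
      by blast
  qed
  moreover have "G {i} = (\<Sum>T\<in>?I. F T {i})"
    using G[OF i] by (simp add: faces_def)
  ultimately show ?thesis
    by (simp add: W_vertex_def sum.distrib)
qed

section \<open>Assembling the identity over the maximal simplexes at a vertex\<close>

theorem proposition8:
  fixes K :: "'v::finite set set"
    and V :: "'v set \<Rightarrow> ('a, 'e::euclidean_space) manifold"
    and L :: "'v set \<Rightarrow> ('v set \<Rightarrow> 'a) \<Rightarrow> real"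
    and \<Lambda> :: "'v set \<Rightarrow> real \<Rightarrow> 'a \<Rightarrow> 'a"
    and \<Phi> :: "'v set \<Rightarrow> 'a"
    and p :: "'v \<Rightarrow> 'v set \<Rightarrow> real"
    and m :: nat
    and i :: 'v
  assumes complex: "abstract_complex K"
    and dim: "K \<noteq> {}" "m = Max (simplex_dim ` K)"
    and fibers: "\<And>S. S \<in> K \<Longrightarrow> smooth_manifold (V S)"
    and lagrangian: "\<And>T. T \<in> simplexes_of_dim K m \<Longrightarrow> differentiable_on_fibers V T (L T)"
    and group: "\<And>S. S \<in> K \<Longrightarrow> one_parameter_group (V S) (\<Lambda> S)"
    and invariance: "\<And>T. T \<in> simplexes_of_dim K m \<Longrightarrow> invariant_lagrangian V \<Lambda> T (L T)"
    and field: "\<Phi> \<in> fields K V"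
    and weights: "weights K p"
    and vertex: "{i} \<in> K"
  shows "real (m + 1) * W_vertex K p (F_global K m V L \<Lambda> \<Phi>) i =
    (\<Sum>j | {i, j} \<in> simplexes_of_dim K 1. V_edge K m p (F_local V L \<Lambda> \<Phi>) i j)"
proof -
  let ?F = "F_local V L \<Lambda> \<Phi>"
  let ?\<T> = "simplexes_of_dim K m"
  let ?I = "{T. T \<in> ?\<T> \<and> i \<in> T}"
  let ?J = "{j. {i, j} \<in> simplexes_of_dim K 1}"
  have \<T>K: "?\<T> \<subseteq> K"
    by (auto simp: simplexes_of_dim_def)
  then have faces_K: "faces T \<subseteq> K" if "T \<in> ?\<T>" for T
    using complex that by (auto simp: abstract_complex_def faces_def)
  have point: "\<Phi> S \<in> points (V S)" if "S \<in> K" for S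
    using field that by (auto simp: fields_def)
  have over: "fibers_over_simplex V L \<Lambda> \<Phi> T" if "T \<in> ?\<T>" for T
    using faces_K[OF that] lagrangian[OF that] fibers group point
    by unfold_locales auto
  have global: "F_global K m V L \<Lambda> \<Phi> S = (\<Sum>T | T \<in> ?\<T> \<and> S \<in> faces T. ?F T S)" if "S \<in> K" for S
    by (rule F_global_eq_sum[OF over fibers group point]) (use that in auto)
  have local: "(\<Sum>j\<in>T - {i}. V_local p (?F T) T i j) = real (m + 1) * W_vertex (faces T) p (?F T) i"
    if T: "T \<in> ?I" for T
  proof -
    have "(\<Sum>j\<in>T - {i}. V_local p (?F T) T i j) = real (card T) * W_vertex (faces T) p (?F T) i"
    proof (rule sum_V_local)
      fix R assume "R \<in> faces T" "card R \<noteq> 1"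
      \<comment> \<open>Faces are nonempty, so \<open>R\<close> has at least two vertices and the
        truncated subtraction in \<open>simplex_dim\<close> gives at least 1.\<close>
      moreover from this have "card R \<noteq> 0"
        by (auto simp: faces_def)
      ultimately have "simplex_dim R \<ge> 1"
        unfolding simplex_dim_def by linarith
      moreover have "R \<in> K"
        using \<open>R \<in> faces T\<close> T faces_K by blast
      ultimately show "(\<Sum>i\<in>R. p i (R - {i})) = 1"
        using weights by (simp add: weights_def)
    next
      show "(\<Sum>S\<in>faces T. ?F T S) = 0"
        using T by (intro fibers_over_simplex.sum_F_local_eq_0 over invariance) auto
    qed (use T in auto)
    \<comment> \<open>\<open>T\<close> contains \<open>i\<close>, so its cardinality is positive and
      subtracting 1 truncates nothing.\<close>
    moreover have "card T = m + 1"
      using T by (auto simp: simplexes_of_dim_def simplex_dim_def card_gt_0_iff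
          intro!: Suc_pred[symmetric, simplified])
    ultimately show ?thesis
      by simp
  qed
  \<comment> \<open>Dimension 1 excludes \<open>j = i\<close>; conversely every edge from
    \<open>i\<close> to another vertex of \<open>T\<close> is a face of \<open>T\<close> and so lies
    in \<open>K\<close>.\<close>
  have link: "{j \<in> ?J. j \<in> T} = T - {i}" if "T \<in> ?I" for T
    using that faces_K[of T]
    by (auto simp: simplexes_of_dim_def simplex_dim_def faces_def card_insert_if)
  have "(\<Sum>j\<in>?J. V_edge K m p ?F i j) = (\<Sum>j\<in>?J. \<Sum>T | T \<in> ?I \<and> j \<in> T. V_local p (?F T) T i j)"
    by (simp add: V_edge_def conj_assoc)
  \<comment> \<open>Exchanging the sums groups the edges at \<open>i\<close> by the maximal
    simplexes containing them.\<close>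
  also have "\<dots> = (\<Sum>T\<in>?I. \<Sum>j | j \<in> ?J \<and> j \<in> T. V_local p (?F T) T i j)"
    by (rule sum.swap_restrict) simp_all
  also have "\<dots> = (\<Sum>T\<in>?I. real (m + 1) * W_vertex (faces T) p (?F T) i)"
    using link local by (intro sum.cong) auto
  also have "\<dots> = real (m + 1) * W_vertex K p (F_global K m V L \<Lambda> \<Phi>) i"
    using W_vertex_eq_sum[OF complex \<T>K global vertex, of p] by (simp add: sum_distrib_left)
  finally show ?thesis ..
qed

end
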